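(* Let $f:[0,1]^2\to[0,1]$ be the digit-interleaving function and let $(A_n)_{n\in\mathbb{N}}$ be the sequence of subsets of $[0,1]^2$, both as defined in the context. Then the function $f^*$ defined on $[0,1]^2$ by \[ f^*(x,y)=\begin{cases} f(x,y) & \text{if } (x,y)\in\bigcup_{n\in\mathbb{N}}A_n,\\ x & \text{otherwise}\end{cases} \] is a bijection from $[0,1]^2$ to $[0,1]$.
   Context: Here $\mathbb{N}=\{0,1,2,\dots\}$. For a real number $x\in[0,1)$, its proper decimal expansion is the unique sequence $(x_k)_{k\ge 1}$ of digits in $\{0,1,\dots,9\}$ such that $x=\sum_{k=1}^{+\infty}x_k/10^k$ and there is no $k_0$ such that $x_k=9$ for all $k>k_0$. The function $f:[0,1]^2\to[0,1]$ is defined as follows, where $(x_k)_{k\ge1}$ and $(y_k)_{k\ge1}$ denote the proper decimal expansions of $x$ and $y$ whenever these numbers lie in $[0,1)$: \[ f(x,y)=\begin{cases} \sum_{k=1}^{+\infty}\frac{x_k}{10^{2k-1}}+\sum_{k=1}^{+\infty}\frac{y_k}{10^{2k}} & \text{if }(x,y)\in[0,1)^2,\\[2pt] \sum_{k=1}^{+\infty}\frac{9}{10^{2k-1}}+\sum_{k=1}^{+\infty}\frac{y_k}{10^{2k}} & \text{if }(x,y)\in\{1\}\times[0,1),\\[2pt] \sum_{k=1}^{+\infty}\frac{x_k}{10^{2k-1}}+\sum_{k=1}^{+\infty}\frac{9}{10^{2k}} & \text{if }(x,y)\in[0,1)\times\{1\},\\[2pt] 1 & \text{if }(x,y)=(1,1).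 \end{cases} \] The function $g:[0,1]\to[0,1]^2$ is defined by $g(t)=(t,0)$. The sets $A_n\subseteq[0,1]^2$ and $B_n\subseteq[0,1]$ are defined recursively by \[ A_0=[0,1]^2\setminus g([0,1])=[0,1]\times(0,1],\qquad B_n=f(A_n)\ \ (n\in\mathbb{N}),\qquad A_n=g(B_{n-1})=B_{n-1}\times\{0\}\ \ (n\ge1). \] *)

theory Defs
  imports Complex_Main
begin

text \<open>The digit sequence is indexed by \<open>k \<ge> 1\<close>, as in the mathematics; the value at
  \<open>0\<close> is not a digit and is normalised to \<open>0\<close>, so that the expansion is unique as a
  function on \<^typ>\<open>nat\<close>.\<close>

definition is_proper_expansion :: "real \<Rightarrow> (nat \<Rightarrow> nat) \<Rightarrow> bool" where
  "is_proper_expansion x d \<longleftrightarrow>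
     d 0 = 0 \<and> (\<forall>k\<ge>1. d k \<in> {0..9}) \<and>
     (\<lambda>k. real (d (Suc k)) / 10 ^ Suc k) sums x \<and>
     \<not> (\<exists>k0. \<forall>k>k0. d k = 9)"

definition digit :: "real \<Rightarrow> nat \<Rightarrow> nat" where
  "digit x = (THE d. is_proper_expansion x d)"

text \<open>Series over \<open>k \<ge> 1\<close> are written with \<^term>\<open>Suc k\<close> in place of \<open>k\<close>. Values of
  the function outside the unit square are irrelevant and set to \<open>0\<close>.\<close>

definition interleave :: "real \<times> real \<Rightarrow> real" where
  "interleave = (\<lambda>(x, y).
     if (x, y) \<in> {0..<1} \<times> {0..<1} then
       (\<Sum>k. real (digit x (Suc k)) / 10 ^ (2 * Suc k - 1)) +
       (\<Sum>k. real (digit y (Suc k)) / 10 ^ (2 * Suc k))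
     else if (x, y) \<in> {1} \<times> {0..<1} then
       (\<Sum>k. 9 / 10 ^ (2 * Suc k - 1)) +
       (\<Sum>k. real (digit y (Suc k)) / 10 ^ (2 * Suc k))
     else if (x, y) \<in> {0..<1} \<times> {1} then
       (\<Sum>k. real (digit x (Suc k)) / 10 ^ (2 * Suc k - 1)) +
       (\<Sum>k. 9 / 10 ^ (2 * Suc k))
     else if (x, y) = (1, 1) then 1
     else 0)"

definition embed :: "real \<Rightarrow> real \<times> real" where
  "embed t = (t, 0)"

fun Aset :: "nat \<Rightarrow> (real \<times> real) set" and Bset :: "nat \<Rightarrow> real set" where
  "Aset 0 = {0..1} \<times> {0..1} - embed ` {0..1}"
| "Aset (Suc n) = embed ` Bset n"
| "Bset n = interleave ` Aset n"

lemma Aset_0: "Aset 0 = {0..1} \<times> {0<..1}"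
  by (auto simp: embed_def)

lemma Aset_Suc: "Aset (Suc n) = Bset n \<times> {0}"
  by (auto simp: embed_def)

definition f_star :: "real \<times> real \<Rightarrow> real" where
  "f_star = (\<lambda>(x, y). if (x, y) \<in> (\<Union>n. Aset n) then interleave (x, y) else x)"

end

theory Submission imports Defs begin

text \<open>
  Give the number \<open>1\<close> the constant digit sequence 9. Then \<open>f\<close> interleaves digit sequences, and the
  interleaved sequence is again not eventually 9, except for \<open>f (1, 1)\<close>, where it is constantly 9.
  Sequences of these two kinds are determined by their value, so \<open>f\<close> is injective, and \<open>f\<^sup>*\<close> is the
  bijection that the proof of the Schroeder-Bernstein theorem builds from \<open>f\<close> and \<open>g\<close>.
\<close>

section \<open>Values of digit sequences indexed from 0\<close>

definition decimal_val :: "(nat \<Rightarrow> nat) \<Rightarrow> real" where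
  "decimal_val a = (\<Sum>k. real (a k) / 10 ^ Suc k)"

definition digit_seq :: "(nat \<Rightarrow> nat) \<Rightarrow> bool" where
  "digit_seq a \<longleftrightarrow> (\<forall>k. a k \<le> 9)"

definition proper_seq :: "(nat \<Rightarrow> nat) \<Rightarrow> bool" where
  "proper_seq a \<longleftrightarrow> digit_seq a \<and> (\<forall>n. \<exists>k\<ge>n. a k \<noteq> 9)"

lemma digit_seqD: "digit_seq a \<Longrightarrow> a k \<le> 9"
  by (simp add: digit_seq_def)

lemma digit_seq_Suc: "digit_seq a \<Longrightarrow> digit_seq (\<lambda>k. a (Suc k))"
  by (simp add: digit_seq_def)

lemma proper_seq_Suc: "proper_seq a \<Longrightarrow> proper_seq (\<lambda>k. a (Suc k))"
  unfolding proper_seq_def using digit_seq_Suc by (metis Suc_le_D Suc_le_mono)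

lemma sums_nines: "(\<lambda>k. 9 / 10 ^ Suc k :: real) sums 1"
  using sums_mult[OF geometric_sums[of "1/10::real"], of "9/10"]
  by (simp add: power_divide)

lemma decimal_summable:
  assumes "digit_seq a"
  shows "summable (\<lambda>k. real (a k) / 10 ^ Suc k)"
proof (rule summable_comparison_test')
  show "summable (\<lambda>k. 9 / 10 ^ Suc k :: real)"
    using sums_nines by (rule sums_summable)
  show "norm (real (a k) / 10 ^ Suc k) \<le> 9 / 10 ^ Suc k" if "k \<ge> 0" for k
    using digit_seqD[OF assms, of k] by (simp add: divide_right_mono)
qed

lemma decimal_sums:
  "digit_seq a \<Longrightarrow> (\<lambda>k. real (a k) / 10 ^ Suc k) sums decimal_val a"
  unfolding decimal_val_def by (rule summable_sums[OF decimal_summable])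

lemma decimal_val_nonneg: "digit_seq a \<Longrightarrow> 0 \<le> decimal_val a"
  unfolding decimal_val_def by (rule suminf_nonneg[OF decimal_summable]) simp_all

lemma decimal_val_le_1:
  assumes "digit_seq a"
  shows "decimal_val a \<le> 1"
  using digit_seqD[OF assms]
  by (intro sums_le[OF _ decimal_sums[OF assms] sums_nines]) (simp add: divide_right_mono)

lemma decimal_val_nines: "decimal_val (\<lambda>_. 9) = 1"
  using sums_nines by (simp add: decimal_val_def sums_iff)

text \<open>Multiplication by 10 shifts the expansion by one place. The inductions on digit
  positions below peel off the leading digit with this recursion.\<close>

lemma decimal_val_Suc:
  assumes "digit_seq a"
  shows "10 * decimal_val a = real (a 0) + decimal_val (\<lambda>k. a (Suc k))"
proof -
  have "(\<lambda>k. real (a (Suc k)) / 10 ^ Suc k / 10) sums (decimal_val (\<lambda>k. a (Suc k)) / 10)"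
    by (intro sums_divide decimal_sums digit_seq_Suc assms)
  then have "(\<lambda>k. real (a k) / 10 ^ Suc k) sums
      (decimal_val (\<lambda>k. a (Suc k)) / 10 + real (a 0) / 10)"
    using sums_Suc[of "\<lambda>k. real (a k) / 10 ^ Suc k"] by (simp add: mult.commute)
  with decimal_sums[OF assms] show ?thesis
    using sums_unique2 by fastforce
qed

text \<open>The backward direction is an induction on the position of a digit other than 9: a
  leading digit at most 8 gives a value at most (8 + 1)/10; otherwise the tail has value below 1 and
  the whole stays below (9 + 1)/10.\<close>

lemma decimal_val_less_1_iff:
  assumes "digit_seq a"
  shows "decimal_val a < 1 \<longleftrightarrow> (\<exists>k. a k \<noteq> 9)"
proof
  assume "decimal_val a < 1"
  then show "\<exists>k. a k \<noteq> 9"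
    using decimal_val_nines by (metis ext less_irrefl)
next
  assume "\<exists>k. a k \<noteq> 9"
  then obtain k where "a k \<noteq> 9" ..
  then show "decimal_val a < 1"
    using assms
  proof (induction k arbitrary: a)
    case 0
    then have "a 0 \<le> 8"
      using digit_seqD[of a 0] by simp
    then have "real (a 0) \<le> 8"
      by simp
    then show ?case
      using decimal_val_Suc[OF \<open>digit_seq a\<close>] decimal_val_le_1[OF digit_seq_Suc[OF \<open>digit_seq a\<close>]]
      by linarith
  next
    case (Suc k)
    then have "decimal_val (\<lambda>k. a (Suc k)) < 1"
      by (simp add: digit_seq_Suc)
    moreover have "real (a 0) \<le> 9"
      using digit_seqD[OF \<open>digit_seq a\<close>, of 0] by simp
    ultimately show ?case
      using decimal_val_Suc[OF \<open>digit_seq a\<close>] by linarith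
  qed
qed

lemma proper_seq_val_less_1: "proper_seq a \<Longrightarrow> decimal_val a < 1"
  unfolding proper_seq_def using decimal_val_less_1_iff by blast

text \<open>The tail is proper again, so its value lies in [0, 1) and is exactly what the floor
  removes.\<close>

lemma proper_seq_hd:
  assumes "proper_seq a"
  shows "\<lfloor>10 * decimal_val a\<rfloor> = int (a 0)"
proof -
  have "digit_seq a"
    using assms by (simp add: proper_seq_def)
  then show ?thesis
    using decimal_val_Suc decimal_val_nonneg[OF digit_seq_Suc]
      proper_seq_val_less_1[OF proper_seq_Suc[OF assms]]
    by (intro floor_unique) auto
qed

text \<open>By \<open>proper_seq_hd\<close>, equal values force equal leading digits and hence tails
  of equal value, so induction on the position reaches every digit.\<close>

lemma proper_seq_eqI:
  assumes "proper_seq a" "proper_seq b" "decimal_val a = decimal_val b"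
  shows "a = b"
proof
  fix k
  show "a k = b k"
    using assms
  proof (induction k arbitrary: a b)
    case 0
    then show ?case
      by (metis proper_seq_hd of_nat_eq_iff)
  next
    case (Suc k)
    have "a 0 = b 0"
      using Suc.prems by (metis proper_seq_hd of_nat_eq_iff)
    moreover have "digit_seq a" "digit_seq b"
      using Suc.prems by (simp_all add: proper_seq_def)
    ultimately have "decimal_val (\<lambda>k. a (Suc k)) = decimal_val (\<lambda>k. b (Suc k))"
      using decimal_val_Suc[of a] decimal_val_Suc[of b] Suc.prems(3) by simp
    then show ?case
      using Suc.IH[OF proper_seq_Suc proper_seq_Suc] Suc.prems by blast
  qed
qed

section \<open>Existence and uniqueness of proper expansions\<close>

lemma ex_proper_seq:
  assumes "0 \<le> x" "x < 1"
  obtains a where "proper_seq a" "decimal_val a = x"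
proof -
  \<comment> \<open>The real argument of \<open>a\<close> is kept variable because properness is
    read off from the sequences of the scaled numbers \<open>10 ^ n * x\<close>.\<close>
  define a where "a x k = nat \<lfloor>10 * frac (10 ^ k * x)\<rfloor>" for x :: real and k
  \<comment> \<open>Divided by \<open>10 ^ Suc k\<close>, this difference makes the digit series
    telescope.\<close>
  have a_eq: "real (a x k) = 10 * frac (10 ^ k * x) - frac (10 ^ Suc k * x)" for x k
  proof -
    have "10 ^ Suc k * x = 10 * frac (10 ^ k * x) + of_int (10 * \<lfloor>10 ^ k * x\<rfloor>)"
      by (simp add: frac_def)
    then have "\<lfloor>10 ^ Suc k * x\<rfloor> = \<lfloor>10 * frac (10 ^ k * x)\<rfloor> + 10 * \<lfloor>10 ^ k * x\<rfloor>"
      by (metis floor_add_int)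
    moreover have "real (a x k) = of_int \<lfloor>10 * frac (10 ^ k * x)\<rfloor>"
      by (simp add: a_def frac_ge_0)
    ultimately show ?thesis
      by (simp add: frac_def)
  qed
  have digs: "digit_seq (a x)" for x
  proof -
    have "a x k \<le> 9" for k
      using a_eq[of x k] frac_lt_1[of "10 ^ k * x"] frac_ge_0[of "10 ^ Suc k * x"] by linarith
    then show ?thesis
      by (simp add: digit_seq_def)
  qed
  have val: "decimal_val (a x) = frac x" for x
  proof -
    \<comment> \<open>The vanishing remainder leaves only the initial term \<open>frac x\<close> of
      the telescoping series.\<close>
    have "(\<lambda>k. frac (10 ^ k * x) / 10 ^ k) \<longlonglongrightarrow> 0"
    proof (rule tendsto_sandwich)
      show "\<forall>\<^sub>F k in sequentially. 0 \<le> frac (10 ^ k * x) / 10 ^ k"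
        by (simp add: frac_ge_0)
      show "\<forall>\<^sub>F k in sequentially. frac (10 ^ k * x) / 10 ^ k \<le> (1 / 10) ^ k"
        by (intro always_eventually)
          (simp add: power_divide divide_right_mono less_imp_le[OF frac_lt_1])
      show "(\<lambda>k. (1 / 10) ^ k :: real) \<longlonglongrightarrow> 0"
        by (rule LIMSEQ_power_zero) simp
    qed simp
    from telescope_sums'[OF this]
    have "(\<lambda>k. frac (10 ^ k * x) / 10 ^ k - frac (10 ^ Suc k * x) / 10 ^ Suc k) sums frac x"
      by simp
    also have "(\<lambda>k. frac (10 ^ k * x) / 10 ^ k - frac (10 ^ Suc k * x) / 10 ^ Suc k)
        = (\<lambda>k. real (a x k) / 10 ^ Suc k)"
      by (simp add: a_eq diff_divide_distrib)
    finally show ?thesis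
      by (simp add: decimal_val_def sums_iff)
  qed
  have "\<exists>k\<ge>n. a x k \<noteq> 9" for n
  proof -
    \<comment> \<open>The digits from position \<open>n\<close> on are those of \<open>frac (10 ^ n * x) < 1\<close>.\<close>
    have "decimal_val (a (10 ^ n * x)) < 1"
      by (simp add: val frac_lt_1)
    then obtain k where "a (10 ^ n * x) k \<noteq> 9"
      using decimal_val_less_1_iff digs by blast
    moreover have "a (10 ^ n * x) k = a x (n + k)"
      by (simp add: a_def power_add mult_ac)
    ultimately show ?thesis
      by (metis le_add1)
  qed
  then have "proper_seq (a x)"
    by (simp add: proper_seq_def digs)
  moreover have "decimal_val (a x) = x"
    using assms by (simp add: val frac_eq)
  ultimately show ?thesis
    by (rule that)
qed

text \<open>Passage from one-based expansions to sequences indexed from 0. The convergence clause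
  reduces to an equation of values because digit series always converge.\<close>

lemma is_proper_expansion_iff:
  "is_proper_expansion x d \<longleftrightarrow>
     d 0 = 0 \<and> proper_seq (\<lambda>k. d (Suc k)) \<and> decimal_val (\<lambda>k. d (Suc k)) = x"
proof -
  have digs: "(\<forall>k\<ge>1. d k \<in> {0..9}) \<longleftrightarrow> digit_seq (\<lambda>k. d (Suc k))"
    by (auto simp: digit_seq_def) (metis Suc_le_D)
  have ev: "(\<exists>k0. \<forall>k>k0. d k = 9) \<longleftrightarrow> \<not> (\<forall>n. \<exists>k\<ge>n. d (Suc k) \<noteq> 9)"
    by (metis Suc_le_D Suc_le_eq Suc_le_mono)
  have "(\<lambda>k. real (d (Suc k)) / 10 ^ Suc k) sums x \<longleftrightarrow> decimal_val (\<lambda>k. d (Suc k)) = x"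
    if "digit_seq (\<lambda>k. d (Suc k))"
    using decimal_sums[OF that] sums_unique2 by blast
  then show ?thesis
    unfolding is_proper_expansion_def digs ev proper_seq_def by auto
qed

lemma digit_proper:
  assumes "0 \<le> x" "x < 1"
  shows "is_proper_expansion x (digit x)"
proof -
  obtain a where a: "proper_seq a" "decimal_val a = x"
    using ex_proper_seq assms by blast
  \<comment> \<open>The 0 in front is the prescribed dummy value at index 0; fixing it makes the
    expansion unique as a function.\<close>
  then have "is_proper_expansion x (case_nat 0 a)"
    by (simp add: is_proper_expansion_iff)
  moreover have "d = case_nat 0 a" if "is_proper_expansion x d" for d
  proof -
    have "(\<lambda>k. d (Suc k)) = a"
      using that a by (intro proper_seq_eqI) (auto simp: is_proper_expansion_iff)
    then show ?thesis
      using that by (auto simp: is_proper_expansion_iff fun_eq_iff split: nat.split)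
  qed
  ultimately show ?thesis
    unfolding digit_def by (rule theI)
qed

section \<open>Interleaving of digit sequences\<close>

definition digits01 :: "real \<Rightarrow> nat \<Rightarrow> nat" where
  "digits01 x = (if x = 1 then (\<lambda>_. 9) else (\<lambda>k. digit x (Suc k)))"

text \<open>Position \<open>k\<close> carries the weight \<open>1 / 10 ^ Suc k\<close>, so the even
  positions are the odd decimal places, which belong to the first coordinate.\<close>

definition mix :: "(nat \<Rightarrow> nat) \<Rightarrow> (nat \<Rightarrow> nat) \<Rightarrow> nat \<Rightarrow> nat" where
  "mix a b k = (if even k then a (k div 2) else b (k div 2))"

lemma digits01_proper: "x \<in> {0..<1} \<Longrightarrow> proper_seq (digits01 x)"
  using digit_proper[of x] by (simp add: digits01_def is_proper_expansion_iff)

lemma digits01_digit_seq: "x \<in> {0..1} \<Longrightarrow> digit_seq (digits01 x)"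
  using digits01_proper[of x]
  by (cases "x = 1") (auto simp: digits01_def proper_seq_def digit_seq_def)

lemma decimal_val_digits01: "x \<in> {0..1} \<Longrightarrow> decimal_val (digits01 x) = x"
  using digit_proper[of x]
  by (cases "x = 1") (auto simp: digits01_def decimal_val_nines is_proper_expansion_iff)

lemma mix_even: "mix a b (2 * k) = a k" and mix_odd: "mix a b (Suc (2 * k)) = b k"
  by (simp_all add: mix_def)

lemma mix_inject: "mix a b = mix a' b' \<longleftrightarrow> a = a' \<and> b = b'"
  by (metis ext mix_even mix_odd)

lemma mix_digit_seq: "digit_seq a \<Longrightarrow> digit_seq b \<Longrightarrow> digit_seq (mix a b)"
  by (simp add: digit_seq_def mix_def)

text \<open>A digit other than 9 at some \<open>k\<close> with \<open>k \<ge> n\<close> reappears at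
  \<open>2 * k\<close> or \<open>Suc (2 * k)\<close>, hence no earlier than
  \<open>n\<close>.\<close>

lemma mix_proper:
  assumes "digit_seq a" "digit_seq b" "proper_seq a \<or> proper_seq b"
  shows "proper_seq (mix a b)"
proof -
  have "\<exists>k\<ge>n. mix a b k \<noteq> 9" for n
  proof -
    consider k where "k \<ge> n" "a k \<noteq> 9" | k where "k \<ge> n" "b k \<noteq> 9"
      using assms(3) unfolding proper_seq_def by blast
    then show ?thesis
    proof cases
      case (1 k)
      then show ?thesis
        by (intro exI[of _ "2 * k"]) (simp add: mix_even)
    next
      case (2 k)
      then show ?thesis
        by (intro exI[of _ "Suc (2 * k)"]) (simp add: mix_odd)
    qed
  qed
  then show ?thesis
    by (simp add: proper_seq_def mix_digit_seq assms)
qed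

lemma decimal_val_mix:
  assumes "digit_seq a" "digit_seq b"
  shows "(\<Sum>k. real (a k) / 10 ^ (2 * Suc k - 1)) + (\<Sum>k. real (b k) / 10 ^ (2 * Suc k))
    = decimal_val (mix a b)"
proof -
  \<comment> \<open>The odd decimal places are \<open>i = 1\<close>, the even ones
    \<open>i = 0\<close>; either way the exponent is at least \<open>Suc k\<close>.\<close>
  have summable: "summable (\<lambda>k. real (c k) / 10 ^ (2 * Suc k - i))"
    if "digit_seq c" "i \<le> 1" for c i
  proof (rule summable_comparison_test'[OF decimal_summable[OF that(1)]])
    show "norm (real (c k) / 10 ^ (2 * Suc k - i)) \<le> real (c k) / 10 ^ Suc k"
      if "k \<ge> 0" for k
      using \<open>i \<le> 1\<close> by (simp add: divide_left_mono power_increasing del: power_Suc)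
  qed
  let ?f = "\<lambda>k. real (a k) / 10 ^ (2 * Suc k - 1)" and ?g = "\<lambda>k. real (b k) / 10 ^ (2 * Suc k)"
  \<comment> \<open>\<open>sums_if\<close> merges two convergent series by parity and lists the sum
    over the odd positions first.\<close>
  have "(\<lambda>k. if even k then ?f (k div 2) else ?g ((k - 1) div 2)) sums (suminf ?g + suminf ?f)"
    using summable[of a 1] summable[of b 0] assms by (intro sums_if summable_sums) simp_all
  also have "(\<lambda>k. if even k then ?f (k div 2) else ?g ((k - 1) div 2))
      = (\<lambda>k. real (mix a b k) / 10 ^ Suc k)"
    by (auto simp: mix_def fun_eq_iff elim!: evenE oddE)
  finally show ?thesis
    by (simp add: decimal_val_def sums_iff)
qed

text \<open>With the expansion 0.999... for 1, the three cases of \<open>interleave\<close> given by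
  series collapse into one formula. Only at (1, 1) is the value set directly, and there the mixed
  sequence is constantly 9.\<close>

lemma interleave_eq:
  assumes "x \<in> {0..1}" "y \<in> {0..1}"
  shows "interleave (x, y) = decimal_val (mix (digits01 x) (digits01 y))"
proof (cases "x = 1 \<and> y = 1")
  case True
  then have "mix (digits01 x) (digits01 y) = (\<lambda>_. 9)"
    by (simp add: digits01_def mix_def fun_eq_iff)
  with True show ?thesis
    by (simp add: interleave_def decimal_val_nines)
next
  case False
  with assms show ?thesis
    unfolding decimal_val_mix[OF digits01_digit_seq digits01_digit_seq, OF assms, symmetric]
    by (auto simp: interleave_def digits01_def)
qed

lemma interleave_mem: "p \<in> {0..1} \<times> {0..1} \<Longrightarrow> interleave p \<in> {0..1}"
  by (auto simp: interleave_eq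
      intro!: decimal_val_nonneg decimal_val_le_1 mix_digit_seq digits01_digit_seq)

text \<open>Away from the corner one coordinate is below 1, and its proper digits keep the mixture
  from ending in nines.\<close>

lemma interleave_less_1:
  assumes "x \<in> {0..1}" "y \<in> {0..1}" "(x, y) \<noteq> (1, 1)"
  shows "proper_seq (mix (digits01 x) (digits01 y))" "interleave (x, y) < 1"
proof -
  have "x \<in> {0..<1} \<or> y \<in> {0..<1}"
    using assms by auto
  then show *: "proper_seq (mix (digits01 x) (digits01 y))"
    using assms by (intro mix_proper digits01_digit_seq) (auto intro: digits01_proper)
  show "interleave (x, y) < 1"
    using proper_seq_val_less_1[OF *] assms by (simp add: interleave_eq)
qed

text \<open>Away from the corner both mixtures are proper, so equal values give equal sequences;
  splitting these by parity returns the digits and thus the coordinates. The corner is the only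
  point with value 1.\<close>

lemma inj_on_interleave: "inj_on interleave ({0..1} \<times> {0..1})"
proof (rule inj_onI, clarify)
  fix x y x' y' :: real
  assume mem: "x \<in> {0..1}" "y \<in> {0..1}" "x' \<in> {0..1}" "y' \<in> {0..1}"
    and eq: "interleave (x, y) = interleave (x', y')"
  have one: "interleave (1, 1) = 1"
    by (simp add: interleave_def)
  show "x = x' \<and> y = y'"
  proof (cases "(x, y) = (1, 1) \<or> (x', y') = (1, 1)")
    case True
    then show ?thesis
      using interleave_less_1(2)[of x y] interleave_less_1(2)[of x' y'] mem eq one by force
  next
    case False
    then have "mix (digits01 x) (digits01 y) = mix (digits01 x') (digits01 y')"
      using mem eq by (intro proper_seq_eqI interleave_less_1(1)) (auto simp: interleave_eq)
    then show ?thesis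
      using mem by (metis mix_inject decimal_val_digits01)
  qed
qed

section \<open>The Schroeder-Bernstein sets and the bijection\<close>

lemma Aset_subset: "Aset n \<subseteq> {0..1} \<times> {0..1}"
proof (induction n)
  case 0
  then show ?case
    by auto
next
  case (Suc n)
  then have "Bset n \<subseteq> {0..1}"
    using interleave_mem by (simp only: Bset.simps) blast
  then show ?case
    by (auto simp: Aset_Suc simp del: Aset.simps Bset.simps)
qed

theorem proposition3: "bij_betw f_star ({0..1} \<times> {0..1}) {0..1}"
proof -
  define U where "U = (\<Union>n. Aset n)"
  have U_sub: "U \<subseteq> {0..1} \<times> {0..1}"
    using Aset_subset by (auto simp: U_def)
  have in_U: "f_star p = interleave p" if "p \<in> U" for p
    using that by (cases p) (simp add: f_star_def U_def)
  have not_in_U: "f_star p = fst p" if "p \<notin> U" for p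
    using that by (cases p) (simp add: f_star_def U_def)
  \<comment> \<open>Points outside \<open>U\<close> avoid \<open>Aset 0\<close>, hence lie on the
    bottom edge, where \<open>fst\<close> inverts \<open>embed\<close>.\<close>
  have snd_0: "snd p = 0" if "p \<in> {0..1} \<times> {0..1} - U" for p
  proof -
    have "p \<notin> Aset 0"
      using that by (auto simp: U_def simp del: Aset.simps)
    then show ?thesis
      using that by (cases p) (auto simp: Aset_0 simp del: Aset.simps)
  qed
  \<comment> \<open>Applying \<open>interleave\<close> and then \<open>embed\<close> leads from
    \<open>Aset n\<close> to \<open>Aset (Suc n)\<close>.\<close>
  have embed_U: "(interleave p, 0) \<in> U" if "p \<in> U" for p
  proof -
    obtain n where "p \<in> Aset n"
      using \<open>p \<in> U\<close> by (auto simp: U_def)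
    then have "(interleave p, 0) \<in> Aset (Suc n)"
      by (simp add: embed_def)
    then show ?thesis
      unfolding U_def by blast
  qed
  \<comment> \<open>Stage 0 holds no point with second coordinate 0, so \<open>(t, 0)\<close>
    belongs to a successor stage, which comes from the stage before it.\<close>
  have U_embed: "\<exists>p\<in>U. interleave p = t" if "(t, 0) \<in> U" for t
  proof -
    obtain n where n: "(t, 0) \<in> Aset n"
      using \<open>(t, 0) \<in> U\<close> by (auto simp: U_def)
    then obtain m where "n = Suc m"
      by (cases n) (auto simp: Aset_0 simp del: Aset.simps)
    with n have "t \<in> interleave ` Aset m"
      by (simp add: embed_def image_iff)
    then show ?thesis
      by (auto simp: U_def)
  qed
  \<comment> \<open>A common value would make \<open>q\<close> the embedding of
    \<open>interleave p\<close>, a point of \<open>U\<close> by \<open>embed_U\<close>.\<close>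
  have mixed: "f_star p \<noteq> f_star q" if "p \<in> U" "q \<in> {0..1} \<times> {0..1} - U" for p q
  proof
    assume "f_star p = f_star q"
    then have "q = (interleave p, 0)"
      using that snd_0[of q] by (simp add: in_U not_in_U prod_eq_iff)
    then show False
      using that embed_U by auto
  qed
  show ?thesis
    unfolding bij_betw_def
  proof
    show "inj_on f_star ({0..1} \<times> {0..1})"
    proof (rule inj_onI)
      fix p q
      assume pq: "p \<in> {0..1} \<times> {0..1}" "q \<in> {0..1} \<times> {0..1}" and eq: "f_star p = f_star q"
      then have "p \<in> U \<longleftrightarrow> q \<in> U"
        using mixed[of p q] mixed[of q p] by auto
      then show "p = q"
      proof (cases "p \<in> U")
        case True
        with \<open>p \<in> U \<longleftrightarrow> q \<in> U\<close> eq have "interleave p = interleave q"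
          by (simp add: in_U)
        then show ?thesis
          using inj_onD[OF inj_on_interleave] pq by blast
      next
        case False
        with \<open>p \<in> U \<longleftrightarrow> q \<in> U\<close> eq pq show ?thesis
          using snd_0[of p] snd_0[of q] by (simp add: not_in_U prod_eq_iff)
      qed
    qed
    show "f_star ` ({0..1} \<times> {0..1}) = {0..1}"
    proof
      show "f_star ` ({0..1} \<times> {0..1}) \<subseteq> {0..1}"
      proof (rule image_subsetI)
        fix p :: "real \<times> real"
        assume "p \<in> {0..1} \<times> {0..1}"
        then show "f_star p \<in> {0..1}"
          using interleave_mem[of p] by (cases "p \<in> U") (auto simp: in_U not_in_U)
      qed
      show "{0..1} \<subseteq> f_star ` ({0..1} \<times> {0..1})"
      proof
        fix t :: real
        assume t: "t \<in> {0..1}"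
        show "t \<in> f_star ` ({0..1} \<times> {0..1})"
        \<comment> \<open>The bottom point over \<open>t\<close> decides: inside \<open>U\<close> it
          yields a preimage under \<open>interleave\<close> in \<open>U\<close>, outside
          \<open>U\<close> it is itself a preimage under \<open>f_star\<close>.\<close>
        proof (cases "(t, 0) \<in> U")
          case True
          then show ?thesis
            using U_embed U_sub in_U by (metis image_eqI subsetD)
        next
          case False
          then have "t = f_star (t, 0)"
            by (simp add: not_in_U)
          then show ?thesis
            using t by (intro image_eqI[of t f_star "(t, 0)"]) auto
        qed
      qed
    qed
  qed
qed

end
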